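(* If $k$ is a non-negative integer, then $$\frac{1}{(q;q)_{\infty}^3}=q^{-\frac{k^2+k}{2}}\sum_{m=k}^\infty \binom{2m+1}{m+k+1}A_{m}(q).$$
   Context: All identities are between formal (Laurent) power series in $q$. The $q$-Pochhammer symbol is $(a;q)_\infty:=(1-a)(1-aq)(1-aq^2)\cdots$, so $(q;q)_\infty=\prod_{n\ge1}(1-q^n)$. For a positive integer $k$, MacMahon's $q$-series is $$A_k(q):=\sum_{0<s_1<s_2<\cdots<s_k}\frac{q^{s_1+s_2+\cdots+s_k}}{(1-q^{s_1})^2(1-q^{s_2})^2\cdots(1-q^{s_k})^2},$$ where the sum runs over strictly increasing $k$-tuples of positive integers, and $A_0(q):=1$. *)

theory Defs
  imports
    "HOL-Analysis.Analysis"
    "HOL-Computational_Algebra.Formal_Laurent_Series"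
begin

text \<open>
  Infinite sums and products are taken in the library's metric topology on formal power series
  and formal Laurent series, where two series are close if their difference has large subdegree.
  The variable \<open>q\<close> is \<^const>\<open>fps_X\<close>, respectively \<^const>\<open>fls_X\<close>.
\<close>

definition qpochhammer_inf :: "'a::field_char_0 fps \<Rightarrow> 'a fps \<Rightarrow> 'a fps" where
  "qpochhammer_inf a q = (\<Prod>n. 1 - a * q ^ n)"

definition pos_strict_tuples :: "nat \<Rightarrow> nat list set" where
  "pos_strict_tuples k = {s. length s = k \<and> sorted_wrt (<) s \<and> (\<forall>x\<in>set s. 0 < x)}"

definition macmahon_A :: "nat \<Rightarrow> 'a::field_char_0 fps" where
  "macmahon_A k =
     (\<Sum>\<^sub>\<infinity>s\<in>pos_strict_tuples k. fps_X ^ sum_list s / (\<Prod>x\<leftarrow>s. (1 - fps_X ^ x)\<^sup>2))"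

text \<open>
  \<^const>\<open>infsum\<close> and \<^const>\<open>prodinf\<close> carry no information when the sum or product does not
  converge. The next two lemmas show that this does not happen in the definitions above.
\<close>

lemma macmahon_A_summable:
  "(\<lambda>s. fps_X ^ sum_list s / (\<Prod>x\<leftarrow>s. (1 - fps_X ^ x)\<^sup>2) :: 'a::field_char_0 fps)
     summable_on pos_strict_tuples k"
proof -
  let ?f = "\<lambda>s. fps_X ^ sum_list s / (\<Prod>x\<leftarrow>s. (1 - fps_X ^ x)\<^sup>2) :: 'a fps"
  have nz: "fps_nth (\<Prod>x\<leftarrow>s. (1 - fps_X ^ x)\<^sup>2 :: 'a fps) 0 \<noteq> 0" if "\<forall>x\<in>set s. 0 < x" for s
    using that by (induction s) (auto simp: fps_nth_power_0 power_0_left)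
  have small: "sum_list s \<le> n" if "s \<in> pos_strict_tuples k" "fps_nth (?f s) n \<noteq> 0" for s n
  proof (rule ccontr)
    assume "\<not> sum_list s \<le> n"
    have "?f s = fps_X ^ sum_list s * inverse (\<Prod>x\<leftarrow>s. (1 - fps_X ^ x)\<^sup>2)"
      by (rule fps_divide_unit, rule nz) (use that(1) in \<open>auto simp: pos_strict_tuples_def\<close>)
    then have "fps_nth (?f s) n = 0"
      using \<open>\<not> sum_list s \<le> n\<close> by (simp only: fps_X_power_mult_nth) simp
    with that show False by simp
  qed
  have fin: "finite {s \<in> pos_strict_tuples k. fps_nth (?f s) n \<noteq> 0}" for n
  proof (rule finite_subset)
    show "{s \<in> pos_strict_tuples k. fps_nth (?f s) n \<noteq> 0} \<subseteq> {s. set s \<subseteq> {..n} \<and> length s = k}"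
    proof safe
      fix s x assume s: "s \<in> pos_strict_tuples k" "fps_nth (?f s) n \<noteq> 0" and x: "x \<in> set s"
      show "x \<le> n" using small[OF s] member_le_sum_list[OF x] by linarith
    qed (auto simp: pos_strict_tuples_def)
  qed (simp add: finite_lists_length_eq)
  have "(?f has_sum Abs_fps (\<lambda>n. \<Sum>s | s \<in> pos_strict_tuples k \<and> fps_nth (?f s) n \<noteq> 0. fps_nth (?f s) n))
          (pos_strict_tuples k)"
    by (rule has_sum_fpsI[OF fin]) simp
  then show ?thesis unfolding summable_on_def by blast
qed

lemma convergent_prod_qpochhammer:
  "convergent_prod (\<lambda>n. 1 - fps_X * fps_X ^ n :: 'a::field_char_0 fps)"
proof -
  let ?P = "\<lambda>N. \<Prod>i\<le>N. 1 - fps_X * fps_X ^ i :: 'a fps"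
  have prod_step: "fps_nth (?P (Suc N)) n = fps_nth (?P N) n" if "n \<le> N" for N n
  proof -
    have "?P (Suc N) = ?P N * (1 - fps_X ^ Suc (Suc N))"
      by simp
    also have "\<dots> = ?P N - fps_X ^ Suc (Suc N) * ?P N"
      unfolding right_diff_distrib mult_1_right by (simp only: mult.commute)
    finally have "fps_nth (?P (Suc N)) n = fps_nth (?P N - fps_X ^ Suc (Suc N) * ?P N) n"
      by (rule arg_cong)
    also have "\<dots> = fps_nth (?P N) n"
      using that unfolding fps_sub_nth fps_X_power_mult_nth by simp
    finally show ?thesis .
  qed
  have stable: "fps_nth (?P N) n = fps_nth (?P n) n" if "n \<le> N" for N n
    using that
  proof (induction N rule: dec_induct)
    case (step m)
    then show ?case by (metis prod_step)
  qed (rule refl)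
  have "?P \<longlonglongrightarrow> Abs_fps (\<lambda>n. fps_nth (?P n) n)"
  proof (rule tendsto_fpsI, rule eventually_sequentiallyI)
    fix n N :: nat
    assume "n \<le> N"
    then show "fps_nth (?P N) n = fps_nth (Abs_fps (\<lambda>n. fps_nth (?P n) n)) n"
      by (subst fps_nth_Abs_fps) (rule stable)
  qed
  moreover have "Abs_fps (\<lambda>n. fps_nth (?P n) n) \<noteq> 0"
  proof
    assume "Abs_fps (\<lambda>n. fps_nth (?P n) n) = 0"
    from arg_cong[OF this, of "\<lambda>f. fps_nth f 0"] show False by simp
  qed
  ultimately have "raw_has_prod (\<lambda>n. 1 - fps_X * fps_X ^ n :: 'a fps) 0 (Abs_fps (\<lambda>n. fps_nth (?P n) n))"
    unfolding raw_has_prod_def add_0_right by (rule conjI)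
  then show ?thesis unfolding convergent_prod_def by blast
qed

lemma macmahon_A_0: "macmahon_A 0 = 1"
proof -
  have "pos_strict_tuples 0 = {[]}" by (auto simp: pos_strict_tuples_def)
  then show ?thesis by (simp add: macmahon_A_def infsumI has_sum_finiteI)
qed

end

theory Submission
  imports Defs
begin

text \<open>
  With \<open>c\<^sub>n = q\<^sup>n / (1 - q\<^sup>n)\<^sup>2\<close> and \<open>x = (1 + z)\<^sup>2 / z\<close>, one has
  \<open>1 + c\<^sub>n x = (1 + z q\<^sup>n) (1 + q\<^sup>n / z) / (1 - q\<^sup>n)\<^sup>2\<close>. The generating function of the elementary
  symmetric polynomials in \<open>c\<^sub>1, \<dots>, c\<^sub>N\<close>, multiplied by \<open>1 + 1 / z\<close>, is therefore a finite Jacobi triple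
  product, and comparing coefficients of powers of \<open>z\<close> gives a finite identity whose right-hand side is a
  Gaussian binomial coefficient over \<open>(q; q)\<^sub>N\<^sup>2\<close>. No \<open>z\<close> is needed to verify it: both sides satisfy the
  same three-term recurrence in \<open>N\<close>. The theorem is the limit \<open>N \<rightarrow> \<infinity>\<close>.
\<close>

subsection \<open>Gaussian binomial coefficients\<close>

text \<open>Defined by a q-Pascal rule rather than as a quotient, so that it makes sense over any
  commutative ring; \<open>qbinom_mult_qfact\<close> recovers the quotient formula.\<close>

fun qbinom :: "'a::comm_ring_1 \<Rightarrow> nat \<Rightarrow> nat \<Rightarrow> 'a" where
  "qbinom q n 0 = 1"
| "qbinom q 0 (Suc k) = 0"
| "qbinom q (Suc n) (Suc k) = qbinom q n k + q ^ Suc k * qbinom q n (Suc k)"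

definition qfact :: "'a::comm_ring_1 \<Rightarrow> nat \<Rightarrow> 'a" where
  "qfact q n = (\<Prod>i<n. 1 - q ^ Suc i)"

lemma qfact_0 [simp]: "qfact q 0 = 1"
  by (simp add: qfact_def)

lemma qfact_Suc: "qfact q (Suc n) = qfact q n * (1 - q ^ Suc n)"
  by (simp add: qfact_def)

lemma qbinom_eq_0: "n < k \<Longrightarrow> qbinom q n k = 0"
  by (induction q n k rule: qbinom.induct) auto

lemma qbinom_self [simp]: "qbinom q n n = 1"
  by (induction n) (auto simp: qbinom_eq_0)

text \<open>The second q-Pascal rule, with the power of q on the other term. Expanding by the
  defining rule, applying the hypothesis to both terms and regrouping gives the induction step.
  Truncation in \<open>n - k\<close> is harmless, because \<open>qbinom q n k\<close> is 0 for k >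
  n.\<close>

lemma qbinom_Suc_Suc':
  "qbinom q (Suc n) (Suc k) = q ^ (n - k) * qbinom q n k + qbinom q n (Suc k)"
proof (induction n arbitrary: k)
  case 0
  show ?case by (cases k) auto
next
  case (Suc n)
  show ?case
  proof (cases "k \<le> n")
    case True
    show ?thesis
    proof (cases k)
      case 0
      have "qbinom q (Suc (Suc n)) (Suc 0) = 1 + q * qbinom q (Suc n) (Suc 0)"
        by simp
      also have "\<dots> = 1 + q * (q ^ n + qbinom q n (Suc 0))"
        by (subst Suc.IH) simp
      also have "\<dots> = q ^ Suc n + qbinom q (Suc n) (Suc 0)"
        by (simp add: algebra_simps)
      finally show ?thesis using 0 by simp
    next
      case (Suc j)
      then obtain d where d: "n = Suc j + d"
        using True le_Suc_ex by blast
      have "qbinom q (Suc (Suc n)) (Suc k) =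
            qbinom q (Suc n) (Suc j) + q ^ Suc k * qbinom q (Suc n) (Suc k)"
        by (simp only: qbinom.simps Suc)
      also have "\<dots> = (q ^ (n - j) * qbinom q n j + qbinom q n (Suc j)) +
            q ^ Suc k * (q ^ (n - k) * qbinom q n k + qbinom q n (Suc k))"
        by (simp only: Suc.IH)
      also have "\<dots> = q ^ (Suc n - k) * (qbinom q n j + q ^ Suc j * qbinom q n (Suc j)) +
            (qbinom q n k + q ^ Suc k * qbinom q n (Suc k))"
        by (simp add: Suc d algebra_simps power_add)
      finally show ?thesis by (simp only: qbinom.simps Suc)
    qed
  next
    case False
    then have "k = Suc n \<or> Suc n < k" by linarith
    then show ?thesis by (elim disjE) (simp_all add: qbinom_eq_0 del: qbinom.simps)
  qed
qed

text \<open>The reflection of k to n - k exchanges the two q-Pascal rules.\<close>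

lemma qbinom_symmetric: "k \<le> n \<Longrightarrow> qbinom q n (n - k) = qbinom q n k"
proof (induction n arbitrary: k)
  case 0
  then show ?case by simp
next
  case (Suc n)
  consider "k = 0" | "k = Suc n" | j d where "k = Suc j" "n = Suc j + d"
    using Suc.prems by (metis le_SucE le_Suc_ex not0_implies_Suc)
  then show ?case
  proof cases
    case 3
    have "qbinom q (Suc n) (Suc n - k) = qbinom q (Suc n) (Suc d)"
      using 3 by simp
    also have "\<dots> = q ^ Suc j * qbinom q n d + qbinom q n (Suc d)"
      by (subst qbinom_Suc_Suc') (simp add: 3)
    also have "\<dots> = q ^ Suc j * qbinom q n (Suc j) + qbinom q n j"
      using Suc.IH[of "Suc j"] Suc.IH[of j] 3 by (simp del: qbinom.simps)
    also have "\<dots> = qbinom q (Suc n) k"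
      using 3 by simp
    finally show ?thesis .
  qed (simp_all del: qbinom.simps(3))
qed

lemma qbinom_mult_qfact:
  "k \<le> n \<Longrightarrow> qbinom q n k * qfact q k * qfact q (n - k) = qfact q n"
proof (induction n arbitrary: k)
  case 0
  then show ?case by simp
next
  case (Suc n)
  consider "k = 0" | "k = Suc n" | j d where "k = Suc j" "n = Suc j + d"
    using Suc.prems by (metis le_SucE le_Suc_ex not0_implies_Suc)
  then show ?case
  proof cases
    case 3
    have IH: "qbinom q n j * qfact q j * qfact q (Suc d) = qfact q n"
      "qbinom q n (Suc j) * qfact q (Suc j) * qfact q d = qfact q n"
      using Suc.IH[of j] Suc.IH[of "Suc j"] 3 by simp_all
    have "qbinom q (Suc n) k * qfact q k * qfact q (Suc n - k) =
       (qbinom q n j + q ^ Suc j * qbinom q n (Suc j)) * qfact q (Suc j) * qfact q (Suc d)"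
      using 3 by simp
    \<comment> \<open>Each product in parentheses equals \<open>qfact q n\<close> by induction, and
      the coefficients add up to 1 - q^(j+d+2) = 1 - q^(n+1).\<close>
    also have "\<dots> = (1 - q ^ Suc j) * (qbinom q n j * qfact q j * qfact q (Suc d)) +
        q ^ Suc j * (1 - q ^ Suc d) * (qbinom q n (Suc j) * qfact q (Suc j) * qfact q d)"
      by (simp add: qfact_Suc algebra_simps)
    also have "\<dots> = qfact q (Suc n)"
      unfolding IH by (simp add: 3 qfact_Suc algebra_simps power_add)
    finally show ?thesis .
  qed (simp_all del: qbinom.simps(3))
qed

subsection \<open>The finite form of the identity\<close>

text \<open>The elementary symmetric polynomial e_m(c_1, ..., c_N). Indexing from 1 matches the
  positive entries of MacMahon's tuples.\<close>

fun elem_sym :: "(nat \<Rightarrow> 'a::comm_ring_1) \<Rightarrow> nat \<Rightarrow> nat \<Rightarrow> 'a" where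
  "elem_sym c 0 N = 1"
| "elem_sym c (Suc m) 0 = 0"
| "elem_sym c (Suc m) (Suc N) = elem_sym c (Suc m) N + c (Suc N) * elem_sym c m N"

lemma elem_sym_eq_0: "N < m \<Longrightarrow> elem_sym c m N = 0"
  by (induction c m N rule: elem_sym.induct) auto

text \<open>The coefficient of z^(k-1) in (1 + 1/z) times the product of 1 + c_n (1+z)^2/z over n =
  1, ..., N. The shift by one makes index 0 available to the recurrence below.\<close>

definition binom_elem_sym_sum :: "(nat \<Rightarrow> 'a::comm_ring_1) \<Rightarrow> nat \<Rightarrow> nat \<Rightarrow> 'a" where
  "binom_elem_sym_sum c N k = (\<Sum>m\<le>N. of_nat ((2 * m + 1) choose (m + k)) * elem_sym c m N)"

text \<open>The symmetry of k and 1 - k at k = 0. It replaces the recurrence there, which would need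
  index -1.\<close>

lemma binom_elem_sym_sum_0_right: "binom_elem_sym_sum c N 0 = binom_elem_sym_sum c N 1"
proof -
  have "(2 * m + 1) choose m = (2 * m + 1) choose (m + 1)" for m :: nat
    using binomial_symmetric[of m "2 * m + 1"] by (simp add: mult_2)
  then show ?thesis by (simp add: binom_elem_sym_sum_def)
qed

text \<open>This is multiplication by the factor 1 + c_{N+1} (z + 2 + 1/z). The weights 1, 2, 1 come
  from applying Pascal's rule twice.\<close>

lemma binom_elem_sym_sum_Suc_Suc:
  "binom_elem_sym_sum c (Suc N) (Suc k) = binom_elem_sym_sum c N (Suc k) + c (Suc N) *
     (binom_elem_sym_sum c N k + 2 * binom_elem_sym_sum c N (Suc k) + binom_elem_sym_sum c N (Suc (Suc k)))"
proof -
  let ?b = "\<lambda>m k. of_nat ((2 * m + 1) choose (m + k)) :: 'a"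
  have b: "?b (Suc m) (Suc k) = ?b m k + 2 * ?b m (Suc k) + ?b m (Suc (Suc k))" for m
    by simp
  have "binom_elem_sym_sum c (Suc N) (Suc k) =
        ?b 0 (Suc k) + (\<Sum>m\<le>N. ?b (Suc m) (Suc k) * elem_sym c (Suc m) (Suc N))"
    unfolding binom_elem_sym_sum_def by (subst sum.atMost_Suc_shift) simp
  also have "\<dots> = (?b 0 (Suc k) + (\<Sum>m\<le>N. ?b (Suc m) (Suc k) * elem_sym c (Suc m) N)) +
      c (Suc N) * (\<Sum>m\<le>N. ?b (Suc m) (Suc k) * elem_sym c m N)"
    by (simp add: sum.distrib sum_distrib_left algebra_simps)
  also have "?b 0 (Suc k) + (\<Sum>m\<le>N. ?b (Suc m) (Suc k) * elem_sym c (Suc m) N) =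
      (\<Sum>m\<le>Suc N. ?b m (Suc k) * elem_sym c m N)"
    by (subst sum.atMost_Suc_shift) simp
  \<comment> \<open>The extra term m = N + 1 vanishes, since there are only N variables.\<close>
  also have "\<dots> = binom_elem_sym_sum c N (Suc k)"
    by (simp add: binom_elem_sym_sum_def elem_sym_eq_0)
  also have "(\<Sum>m\<le>N. ?b (Suc m) (Suc k) * elem_sym c m N) =
      binom_elem_sym_sum c N k + 2 * binom_elem_sym_sum c N (Suc k) + binom_elem_sym_sum c N (Suc (Suc k))"
    unfolding b binom_elem_sym_sum_def
    by (simp only: distrib_right sum.distrib sum_distrib_left mult.assoc)
  finally show ?thesis .
qed

text \<open>One q-Pascal rule followed by the other. The common factor q^k removes the exponents N +
  1 - k and N - k; where these would be negative, the accompanying Gaussian binomial is 0.\<close>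

lemma qbinom_three_term:
  "q ^ k * qbinom q (2 * N + 3) (N + k + 2) =
     q ^ (N + 1) * qbinom q (2 * N + 1) (N + k) +
     q ^ k * (1 + q ^ (2 * N + 2)) * qbinom q (2 * N + 1) (N + k + 1) +
     q ^ (N + 2 * k + 2) * qbinom q (2 * N + 1) (N + k + 2)"
proof -
  let ?G = "qbinom q (2 * N + 1)"
  have G0: "q ^ k * q ^ (N + 1 - k) * ?G (N + k) = q ^ (N + 1) * ?G (N + k)"
    by (cases "k \<le> N + 1") (simp_all add: qbinom_eq_0 del: qbinom.simps flip: power_add power_Suc)
  have G1: "q ^ (N + k + 2) * q ^ (N - k) * ?G (N + k + 1) = q ^ (2 * N + 2) * ?G (N + k + 1)"
    by (cases "k \<le> N") (simp_all add: qbinom_eq_0 mult_2 del: qbinom.simps flip: power_add power_Suc)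
  have "qbinom q (2 * N + 3) (N + k + 2) = qbinom q (Suc (Suc (2 * N + 1))) (Suc (Suc (N + k)))"
    by (rule arg_cong2[of _ _ _ _ "qbinom q"]) simp_all
  also have "\<dots> = qbinom q (Suc (2 * N + 1)) (Suc (N + k)) +
      q ^ (N + k + 2) * qbinom q (Suc (2 * N + 1)) (Suc (N + k + 1))"
    by (subst qbinom.simps(3)) (simp del: qbinom.simps)
  also have "\<dots> = (q ^ (N + 1 - k) * ?G (N + k) + ?G (N + k + 1)) +
      q ^ (N + k + 2) * (q ^ (N - k) * ?G (N + k + 1) + ?G (N + k + 2))"
    unfolding qbinom_Suc_Suc' by simp
  finally have "q ^ k * qbinom q (2 * N + 3) (N + k + 2) =
      q ^ k * q ^ (N + 1 - k) * ?G (N + k) + q ^ k * ?G (N + k + 1) +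
      q ^ k * (q ^ (N + k + 2) * q ^ (N - k) * ?G (N + k + 1)) +
      q ^ k * q ^ (N + k + 2) * ?G (N + k + 2)"
    by (simp only: distrib_left mult.assoc add.assoc)
  also have "q ^ k * q ^ (N + k + 2) = q ^ (N + 2 * k + 2)"
    by (rule trans[OF power_add[symmetric] arg_cong[of _ _ "power q"]]) simp
  finally show ?thesis
    unfolding G0 G1 by (simp only: distrib_left distrib_right mult.assoc add.assoc mult_1_left)
qed

text \<open>The induction on N treats all k at once, because the recurrence uses three neighbouring
  indices. The hypothesis expresses c_n = q^n / (1 - q^n)^2 without division.\<close>

theorem binom_elem_sym_sum_mult_qfact:
  assumes c: "\<And>n. n > 0 \<Longrightarrow> c n * (1 - q ^ n)\<^sup>2 = q ^ n"
  shows "binom_elem_sym_sum c N k * (qfact q N)\<^sup>2 = q ^ (k choose 2) * qbinom q (2 * N + 1) (N + k)"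
proof (induction N arbitrary: k)
  case 0
  have "k = 0 \<or> k = 1 \<or> 1 < k" by linarith
  then show ?case
    by (elim disjE) (simp_all add: binom_elem_sym_sum_def qbinom_eq_0 binomial_eq_0 numeral_2_eq_2
        del: qbinom.simps(3))
next
  case (Suc N)
  have Suc_k: "binom_elem_sym_sum c (Suc N) (Suc k) * (qfact q (Suc N))\<^sup>2 =
      q ^ (Suc k choose 2) * qbinom q (2 * Suc N + 1) (Suc N + Suc k)" for k
  proof -
    let ?B = "binom_elem_sym_sum c N" and ?F = "(qfact q N)\<^sup>2" and ?Q = "q ^ (N + 1)"
    let ?G = "qbinom q (2 * N + 1)" and ?t = "q ^ (k choose 2)"
    have tri: "q ^ (Suc k choose 2) = ?t * q ^ k"
      "q ^ (Suc (Suc k) choose 2) = ?t * q ^ (2 * k + 1)"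
      by (simp_all add: numeral_2_eq_2 power_add ac_simps mult_2)
    have cQ: "c (Suc N) * (1 - ?Q)\<^sup>2 = ?Q"
      using c[of "Suc N"] by simp
    have "binom_elem_sym_sum c (Suc N) (Suc k) * (qfact q (Suc N))\<^sup>2 =
        (1 - ?Q)\<^sup>2 * (?B (Suc k) * ?F) + (c (Suc N) * (1 - ?Q)\<^sup>2) *
          (?B k * ?F + 2 * (?B (Suc k) * ?F) + ?B (Suc (Suc k)) * ?F)"
      unfolding binom_elem_sym_sum_Suc_Suc[of c N k] qfact_Suc[of q N] power_mult_distrib
      unfolding Suc_eq_plus1[of N]
      by (simp only: distrib_left distrib_right mult_ac)
    also have "\<dots> = (1 - ?Q)\<^sup>2 * (?B (Suc k) * ?F) +
          ?Q * (?B k * ?F + 2 * (?B (Suc k) * ?F) + ?B (Suc (Suc k)) * ?F)"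
      unfolding cQ ..
    \<comment> \<open>The middle coefficient is (1 - Q)^2 + 2 Q = 1 + Q^2, as in
      \<open>qbinom_three_term\<close>.\<close>
    also have "\<dots> = (1 + ?Q\<^sup>2) * (?B (Suc k) * ?F) + ?Q * (?B k * ?F) + ?Q * (?B (Suc (Suc k)) * ?F)"
      by (simp add: algebra_simps power2_eq_square)
    also have "\<dots> = ?t * (?Q * ?G (N + k) + q ^ k * (1 + ?Q\<^sup>2) * ?G (N + Suc k) +
        ?Q * q ^ (2 * k + 1) * ?G (N + Suc (Suc k)))"
      unfolding Suc.IH tri by (simp only: distrib_left distrib_right mult_ac add_ac)
    also have "\<dots> = ?t * (q ^ k * qbinom q (2 * N + 3) (N + k + 2))"
    proof -
      have "?Q\<^sup>2 = q ^ (2 * N + 2)"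
        by (rule trans[OF power_mult[symmetric] arg_cong[of _ _ "power q"]]) simp
      moreover have "?Q * q ^ (2 * k + 1) = q ^ (N + 2 * k + 2)"
        by (rule trans[OF power_add[symmetric] arg_cong[of _ _ "power q"]]) simp
      ultimately show ?thesis
        unfolding qbinom_three_term by (simp only:) simp
    qed
    also have "\<dots> = q ^ (Suc k choose 2) * qbinom q (2 * Suc N + 1) (Suc N + Suc k)"
      unfolding tri by (simp add: mult.assoc eval_nat_numeral del: qbinom.simps)
    finally show ?thesis .
  qed
  show ?case
  proof (cases k)
    case 0
    \<comment> \<open>Both sides have equal values at k = 0 and k = 1: the right one by this
      reflection, with exponent 0 on q in both cases.\<close>
    have "qbinom q (2 * Suc N + 1) (Suc N + 1) = qbinom q (2 * Suc N + 1) (Suc N)"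
      using qbinom_symmetric[of "Suc N" "2 * Suc N + 1" q] by (simp add: mult_2 del: qbinom.simps)
    then show ?thesis
      using Suc_k[of 0] 0 by (simp add: binom_elem_sym_sum_0_right numeral_2_eq_2 del: qbinom.simps)
  next
    case (Suc j)
    then show ?thesis using Suc_k by simp
  qed
qed

subsection \<open>Limits of formal power series\<close>

text \<open>Coefficient n of a product depends only on the coefficients up to n of the factors, and
  these finitely many are locally constant. This makes \<open>tendsto_mult\<close>
  applicable.\<close>

instance fps :: (ring) topological_semigroup_mult
proof
  fix a b :: "'a fps"
  have *: "\<forall>\<^sub>F x in nhds f. \<forall>i\<in>{..n}. fps_nth x i = fps_nth f i" for f :: "'a fps" and n
    using tendsto_fps_iff[of "\<lambda>x. x" f "nhds f"] filterlim_ident[of "nhds f"]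
    by (subst eventually_ball_finite_distrib) auto
  have "\<forall>\<^sub>F x in nhds a \<times>\<^sub>F nhds b. fps_nth (fst x * snd x) n = fps_nth (a * b) n" for n
    unfolding eventually_prod_filter fps_mult_nth
    by (intro exI conjI, rule *[of n], rule *[of n]) (auto intro!: sum.cong)
  then show "((\<lambda>x. fst x * snd x) \<longlongrightarrow> a * b) (nhds a \<times>\<^sub>F nhds b)"
    by (rule tendsto_fpsI)
qed

lemma qfact_tendsto_qpochhammer_inf:
    "qfact fps_X \<longlonglongrightarrow> (qpochhammer_inf fps_X fps_X :: 'a::field_char_0 fps)" (is ?lim)
  and qpochhammer_inf_nonzero: "qpochhammer_inf fps_X fps_X \<noteq> (0 :: 'a fps)" (is ?nz)
proof -
  \<comment> \<open>Convergence of an infinite product may skip finitely many zero factors; with no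
    factor zero it yields a nonzero limit of the full partial products.\<close>
  have "fps_nth (1 - fps_X * fps_X ^ i) 0 \<noteq> fps_nth (0 :: 'a fps) 0" for i
    by simp
  then have nz: "1 - fps_X * fps_X ^ i \<noteq> (0 :: 'a fps)" for i
    by metis
  obtain P :: "'a fps" where
    P: "(\<lambda>n. \<Prod>i\<le>n. 1 - fps_X * fps_X ^ i) \<longlonglongrightarrow> P" "P \<noteq> 0"
    using iffD1[OF convergent_prod_iff_nz_lim[OF nz] convergent_prod_qpochhammer] by (elim exE conjE)
  have eq: "qpochhammer_inf fps_X fps_X = P"
    unfolding qpochhammer_inf_def by (rule prodinf_eq_prod_lim[OF P])
  have "(\<lambda>n. qfact fps_X (Suc n)) \<longlonglongrightarrow> P"
    using P(1) by (simp only: qfact_def lessThan_Suc_atMost power_Suc)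
  then show ?lim
    unfolding eq by (rule LIMSEQ_imp_Suc)
  show ?nz
    unfolding eq by (rule P(2))
qed

subsection \<open>MacMahon's series\<close>

definition macmahon_term :: "nat \<Rightarrow> 'a::field_char_0 fps" where
  "macmahon_term n = fps_X ^ n / (1 - fps_X ^ n)\<^sup>2"

lemma macmahon_term_mult:
  assumes "n > 0"
  shows "macmahon_term n * (1 - fps_X ^ n)\<^sup>2 = (fps_X ^ n :: 'a::field_char_0 fps)"
proof -
  have "fps_nth ((1 - fps_X ^ n :: 'a fps)\<^sup>2) 0 \<noteq> 0"
    using assms by (simp add: fps_nth_power_0 power_0_left)
  then show ?thesis
    by (simp add: macmahon_term_def fps_divide_unit mult.assoc inverse_mult_eq_1)
qed

lemma fps_nth_prod_list_one_minus_X_power: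
  "\<forall>x\<in>set s. 0 < x \<Longrightarrow> fps_nth (\<Prod>x\<leftarrow>s. (1 - fps_X ^ x)\<^sup>2 :: 'a::field_char_0 fps) 0 = 1"
  by (induction s) (auto simp: fps_nth_power_0 power_0_left)

lemma prod_list_macmahon_term:
  assumes "\<forall>x\<in>set s. 0 < x"
  shows "(\<Prod>x\<leftarrow>s. macmahon_term x) =
           (fps_X ^ sum_list s / (\<Prod>x\<leftarrow>s. (1 - fps_X ^ x)\<^sup>2) :: 'a::field_char_0 fps)"
proof -
  let ?d = "\<lambda>s. \<Prod>x\<leftarrow>s. (1 - fps_X ^ x)\<^sup>2 :: 'a fps"
  have "?d s \<noteq> 0"
    using fps_nth_prod_list_one_minus_X_power[OF assms, where ?'a = 'a] by fastforce
  have "(\<Prod>x\<leftarrow>s. macmahon_term x) * ?d s = fps_X ^ sum_list s"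
    using assms
  proof (induction s)
    case (Cons x s)
    have "(\<Prod>x\<leftarrow>x # s. macmahon_term x) * ?d (x # s) =
        (macmahon_term x * (1 - fps_X ^ x)\<^sup>2) * ((\<Prod>x\<leftarrow>s. macmahon_term x) * ?d s)"
      by (simp add: ac_simps)
    also have "\<dots> = fps_X ^ sum_list (x # s)"
      using Cons by (simp add: macmahon_term_mult power_add)
    finally show ?case .
  qed simp
  then show ?thesis
    using nonzero_mult_div_cancel_right[OF \<open>?d s \<noteq> 0\<close>] by metis
qed

lemma finite_bounded_tuples: "finite {s \<in> pos_strict_tuples m. set s \<subseteq> {..N}}"
  by (rule finite_subset[OF _ finite_lists_length_eq[of "{..N}" m]]) (auto simp: pos_strict_tuples_def)

text \<open>In a strictly increasing tuple only the last entry can be N + 1. The two cases mirror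
  the recursion of \<open>elem_sym\<close>.\<close>

lemma bounded_tuples_Suc:
  "{s \<in> pos_strict_tuples (Suc m). set s \<subseteq> {..Suc N}} =
     {s \<in> pos_strict_tuples (Suc m). set s \<subseteq> {..N}} \<union>
     (\<lambda>s. s @ [Suc N]) ` {s \<in> pos_strict_tuples m. set s \<subseteq> {..N}}" (is "?L = ?R1 \<union> ?R2")
proof (intro equalityI subsetI)
  fix s assume s: "s \<in> ?L"
  then obtain t a where t: "s = t @ [a]"
    by (cases s rule: rev_cases) (auto simp: pos_strict_tuples_def)
  have *: "t \<in> pos_strict_tuples m" "\<forall>x\<in>set t. x < a" "a \<le> Suc N" "s \<in> pos_strict_tuples (Suc m)"
    using s by (auto simp: t pos_strict_tuples_def sorted_wrt_append)
  show "s \<in> ?R1 \<union> ?R2"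
  proof (cases "a = Suc N")
    case True
    then show ?thesis using * by (auto simp: t less_Suc_eq_le)
  next
    case False
    then have "set s \<subseteq> {..N}" using *(2,3) by (force simp: t)
    then show ?thesis using * by simp
  qed
next
  fix s assume "s \<in> ?R1 \<union> ?R2"
  then show "s \<in> ?L"
    by (auto simp: pos_strict_tuples_def sorted_wrt_append less_Suc_eq_le subset_iff intro: le_SucI)
qed

lemma elem_sym_eq_sum_tuples:
  "elem_sym c m N = (\<Sum>s | s \<in> pos_strict_tuples m \<and> set s \<subseteq> {..N}. \<Prod>x\<leftarrow>s. c x)"
proof (induction c m N rule: elem_sym.induct)
  case (1 c N)
  have "{s. s \<in> pos_strict_tuples 0 \<and> set s \<subseteq> {..N}} = {[]}"
    by (auto simp: pos_strict_tuples_def)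
  then show ?case by simp
next
  case (2 c m)
  have "{s. s \<in> pos_strict_tuples (Suc m) \<and> set s \<subseteq> {..0}} = {}"
    by (auto simp: pos_strict_tuples_def length_Suc_conv)
  then show ?case by (simp only: elem_sym.simps sum.empty)
next
  case (3 c m N)
  let ?T = "\<lambda>m. {s \<in> pos_strict_tuples m. set s \<subseteq> {..N}}"
  have "(\<Sum>s | s \<in> pos_strict_tuples (Suc m) \<and> set s \<subseteq> {..Suc N}. \<Prod>x\<leftarrow>s. c x) =
      (\<Sum>s\<in>?T (Suc m). \<Prod>x\<leftarrow>s. c x) + (\<Sum>s\<in>(\<lambda>s. s @ [Suc N]) ` ?T m. \<Prod>x\<leftarrow>s. c x)"
    unfolding bounded_tuples_Suc
    by (intro sum.union_disjoint finite_imageI finite_bounded_tuples) auto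
  also have "(\<Sum>s\<in>(\<lambda>s. s @ [Suc N]) ` ?T m. \<Prod>x\<leftarrow>s. c x) = c (Suc N) * (\<Sum>s\<in>?T m. \<Prod>x\<leftarrow>s. c x)"
    by (subst sum.reindex) (auto simp: inj_on_def sum_distrib_left mult.commute)
  finally show ?case
    by (simp add: 3)
qed

text \<open>A tuple with an entry above N has sum above n, so its summand is divisible by q^(n+1)
  and does not affect coefficient n.\<close>

lemma fps_nth_macmahon_A:
  assumes "n \<le> N"
  shows "fps_nth (macmahon_A m :: 'a::field_char_0 fps) n = fps_nth (elem_sym macmahon_term m N) n"
proof -
  let ?f = "\<lambda>s. \<Prod>x\<leftarrow>s. macmahon_term x :: 'a fps"
  let ?g = "\<lambda>s. fps_X ^ sum_list s / (\<Prod>x\<leftarrow>s. (1 - fps_X ^ x)\<^sup>2) :: 'a fps"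
  have fg: "?f s = ?g s" if "s \<in> pos_strict_tuples m" for s
    using that by (intro prod_list_macmahon_term) (simp add: pos_strict_tuples_def)
  have "(?f has_sum macmahon_A m) (pos_strict_tuples m)"
    unfolding macmahon_A_def
    by (subst has_sum_cong[OF fg]) (simp_all add: has_sum_infsum macmahon_A_summable)
  from has_sum_fpsD(2)[OF this, of n]
  have "fps_nth (macmahon_A m :: 'a fps) n =
      (\<Sum>s | s \<in> pos_strict_tuples m \<and> fps_nth (?f s) n \<noteq> 0. fps_nth (?f s) n)" .
  also have "\<dots> = (\<Sum>s | s \<in> pos_strict_tuples m \<and> set s \<subseteq> {..N}. fps_nth (?f s) n)"
  proof (rule sum.mono_neutral_left[OF finite_bounded_tuples])
    have "set s \<subseteq> {..N}" if "s \<in> pos_strict_tuples m" "fps_nth (?f s) n \<noteq> 0" for s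
    proof -
      let ?d = "\<Prod>x\<leftarrow>s. (1 - fps_X ^ x)\<^sup>2 :: 'a fps"
      have "\<forall>x\<in>set s. 0 < x"
        using that(1) by (simp add: pos_strict_tuples_def)
      then have "fps_nth ?d 0 \<noteq> 0"
        by (simp add: fps_nth_prod_list_one_minus_X_power)
      then have "?f s = fps_X ^ sum_list s * inverse ?d"
        unfolding fg[OF that(1)] by (rule fps_divide_unit)
      then have "sum_list s \<le> n"
        using that(2) by (auto simp: fps_X_power_mult_nth not_le split: if_splits)
      then show ?thesis
        using assms member_le_sum_list[of _ s] by fastforce
    qed
    then show "{s \<in> pos_strict_tuples m. fps_nth (?f s) n \<noteq> 0} \<subseteq> {s \<in> pos_strict_tuples m. set s \<subseteq> {..N}}"
      by blast
  qed auto
  finally show ?thesis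
    by (simp add: elem_sym_eq_sum_tuples fps_sum_nth)
qed

text \<open>The theorem with denominators cleared. Multiplying the finite identity by
  \<open>qfact\<close> at N + k + 1 and N - k and letting N grow gives L P^4 = q^(k(k+1)/2) P, from
  which one P cancels.\<close>

lemma has_sum_macmahon_A:
  fixes k :: nat
  obtains L :: "'a::field_char_0 fps"
  where "((\<lambda>m. of_nat ((2 * m + 1) choose (m + k + 1)) * macmahon_A m) has_sum L) {k..}"
    and "L * qpochhammer_inf fps_X fps_X ^ 3 = fps_X ^ (Suc k choose 2)"
proof -
  define P where "P = (qpochhammer_inf fps_X fps_X :: 'a fps)"
  let ?F = "\<lambda>m. of_nat ((2 * m + 1) choose (m + k + 1)) * macmahon_A m :: 'a fps"
  let ?S = "\<lambda>N. binom_elem_sym_sum macmahon_term N (Suc k) :: 'a fps"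
  have nth_of_nat: "fps_nth (of_nat a * f) n = of_nat a * fps_nth f n" for a n and f :: "'a fps"
    by (simp add: fps_of_nat[symmetric])
  \<comment> \<open>Taking N = n in \<open>fps_nth_macmahon_A\<close> shows that A_m has no
    coefficients below m, so each coefficient of the series is a finite sum.\<close>
  have zero: "fps_nth (?F m) n = 0" if "n < m" for m n
    unfolding nth_of_nat fps_nth_macmahon_A[OF order_refl] elem_sym_eq_0[OF that] by simp
  have fin: "finite {m \<in> {k..}. fps_nth (?F m) n \<noteq> 0}" for n
  proof (rule finite_subset)
    show "{m \<in> {k..}. fps_nth (?F m) n \<noteq> 0} \<subseteq> {..n}"
      unfolding subset_iff mem_Collect_eq atMost_iff using zero not_le by metis
  qed simp
  define L where "L = Abs_fps (\<lambda>n. \<Sum>m | m \<in> {k..} \<and> fps_nth (?F m) n \<noteq> 0. fps_nth (?F m) n)"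
  have L: "(?F has_sum L) {k..}"
    by (rule has_sum_fpsI[OF fin]) (simp add: L_def)
  have "?S \<longlonglongrightarrow> L"
  proof (rule tendsto_fpsI, rule eventually_sequentiallyI)
    fix n N :: nat
    assume "n \<le> N"
    have "fps_nth (?S N) n = (\<Sum>m\<le>N. fps_nth (?F m) n)"
      unfolding binom_elem_sym_sum_def fps_sum_nth nth_of_nat fps_nth_macmahon_A[OF \<open>n \<le> N\<close>] by simp
    \<comment> \<open>The ranges differ only in zero terms: for m < k the binomial coefficient
      vanishes, and nonzero terms have m at most n, hence at most N.\<close>
    also have "\<dots> = (\<Sum>m | m \<in> {k..} \<and> fps_nth (?F m) n \<noteq> 0. fps_nth (?F m) n)"
    proof (rule sum.mono_neutral_right)
      show "{m. m \<in> {k..} \<and> fps_nth (?F m) n \<noteq> 0} \<subseteq> {..N}"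
      proof safe
        fix m assume "fps_nth (?F m) n \<noteq> 0"
        then have "m \<le> n" using zero not_le by metis
        then show "m \<le> N" using \<open>n \<le> N\<close> by simp
      qed
      have "fps_nth (?F m) n = 0" if "m < k" for m
        unfolding nth_of_nat using that by (simp add: binomial_eq_0 del: binomial_Suc_Suc)
      then show "\<forall>m\<in>{..N} - {m. m \<in> {k..} \<and> fps_nth (?F m) n \<noteq> 0}. fps_nth (?F m) n = 0"
        unfolding Ball_def Diff_iff mem_Collect_eq atLeast_iff by (meson not_le)
    qed simp
    finally show "fps_nth (?S N) n = fps_nth L n"
      by (simp add: L_def)
  qed
  moreover have q: "qfact fps_X \<longlonglongrightarrow> P"
    unfolding P_def by (rule qfact_tendsto_qpochhammer_inf)
  moreover have "(\<lambda>N. qfact fps_X (N + Suc k)) \<longlonglongrightarrow> P"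
    by (rule LIMSEQ_ignore_initial_segment[OF q])
  moreover have "(\<lambda>N. qfact fps_X (N - k)) \<longlonglongrightarrow> P"
    by (rule filterlim_compose[OF q filterlim_minus_const_nat_at_top])
  ultimately have lhs: "(\<lambda>N. ?S N * (qfact fps_X N * qfact fps_X N) *
      (qfact fps_X (N + Suc k) * qfact fps_X (N - k))) \<longlonglongrightarrow> L * (P * P) * (P * P)"
    by (intro tendsto_mult)
  have "(\<lambda>N. qfact fps_X (2 * N + 1)) \<longlonglongrightarrow> P"
    by (rule filterlim_compose[OF q filterlim_subseq]) (simp add: strict_mono_def)
  then have rhs: "(\<lambda>N. fps_X ^ (Suc k choose 2) * qfact fps_X (2 * N + 1))
      \<longlonglongrightarrow> fps_X ^ (Suc k choose 2) * P"
    by (intro tendsto_mult tendsto_const)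
  \<comment> \<open>For N at least k, the two lower \<open>qfact\<close> indices add up to 2 N + 1,
    so these factors clear the Gaussian binomial.\<close>
  have "?S N * (qfact fps_X N * qfact fps_X N) * (qfact fps_X (N + Suc k) * qfact fps_X (N - k)) =
      fps_X ^ (Suc k choose 2) * qfact fps_X (2 * N + 1)" if "N \<ge> k" for N
  proof -
    have "2 * N + 1 - (N + Suc k) = N - k"
      by simp
    then have G: "qbinom fps_X (2 * N + 1) (N + Suc k) * (qfact fps_X (N + Suc k) * qfact fps_X (N - k)) =
        (qfact fps_X (2 * N + 1) :: 'a fps)"
      using qbinom_mult_qfact[of "N + Suc k" "2 * N + 1" "fps_X :: 'a fps"] that
      by (simp del: qbinom.simps add: mult.assoc)
    have S: "?S N * (qfact fps_X N)\<^sup>2 =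
        fps_X ^ (Suc k choose 2) * qbinom fps_X (2 * N + 1) (N + Suc k)"
      by (rule binom_elem_sym_sum_mult_qfact) (rule macmahon_term_mult)
    show ?thesis
      unfolding S[unfolded power2_eq_square] mult.assoc G ..
  qed
  then have "\<forall>\<^sub>F N in sequentially.
      ?S N * (qfact fps_X N * qfact fps_X N) * (qfact fps_X (N + Suc k) * qfact fps_X (N - k)) =
      fps_X ^ (Suc k choose 2) * qfact fps_X (2 * N + 1)"
    by (rule eventually_sequentiallyI)
  from tendsto_cong[OF this] lhs have "L * (P * P) * (P * P) = fps_X ^ (Suc k choose 2) * P"
    using LIMSEQ_unique[OF _ rhs] by blast
  then have "L * P ^ 3 = fps_X ^ (Suc k choose 2)"
  proof -
    have "L * (P * P) * (P * P) = L * P ^ 3 * P"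
      by (simp only: power3_eq_cube mult.assoc)
    moreover have "P \<noteq> 0"
      unfolding P_def by (rule qpochhammer_inf_nonzero)
    ultimately show ?thesis
      using \<open>L * (P * P) * (P * P) = fps_X ^ (Suc k choose 2) * P\<close> by (metis mult_right_cancel)
  qed
  with L show ?thesis unfolding P_def by (rule that)
qed

subsection \<open>Laurent series\<close>

text \<open>The embedding preserves subdegrees, which determine both metrics. Being an isometry it
  is continuous, so infinite sums pass through it.\<close>

lemma dist_fps_to_fls: "dist (fps_to_fls f) (fps_to_fls g) = dist f g"
  for f g :: "'a::group_add fps"
proof -
  have "fps_to_fls f - fps_to_fls g = fps_to_fls (f - g)"
    by simp
  then show ?thesis
    unfolding dist_fls_def dist_fps_def fps_to_fls_eq_iff by (simp only: fls_subdegree_fls_to_fps) simp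
qed

theorem theorem1p1:
  fixes k :: nat
  shows "(\<lambda>m. of_nat ((2 * m + 1) choose (m + k + 1)) *
            fps_to_fls (macmahon_A m :: 'a::field_char_0 fps)) summable_on {k..} \<and>
         1 / fps_to_fls (qpochhammer_inf fps_X fps_X :: 'a fps) ^ 3 =
           fls_X powi (- int ((k\<^sup>2 + k) div 2)) *
             (\<Sum>\<^sub>\<infinity>m\<in>{k..}. of_nat ((2 * m + 1) choose (m + k + 1)) * fps_to_fls (macmahon_A m))"
proof -
  let ?P = "qpochhammer_inf fps_X fps_X :: 'a fps"
  obtain L :: "'a fps" where
    L: "((\<lambda>m. of_nat ((2 * m + 1) choose (m + k + 1)) * macmahon_A m) has_sum L) {k..}" and
    LP: "L * ?P ^ 3 = fps_X ^ (Suc k choose 2)"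
    by (rule has_sum_macmahon_A)
  have "continuous_on UNIV (fps_to_fls :: 'a fps \<Rightarrow> _)"
    unfolding continuous_on_iff dist_fps_to_fls by blast
  from has_sum_homomorphism[OF L _ _ this]
  have sum: "((\<lambda>m. of_nat ((2 * m + 1) choose (m + k + 1)) * fps_to_fls (macmahon_A m :: 'a fps))
      has_sum fps_to_fls L) {k..}"
    by (simp add: fls_times_fps_to_fls)
  have tri: "(k\<^sup>2 + k) div 2 = Suc k choose 2"
    by (simp add: choose_two power2_eq_square)
  have "fps_to_fls L * fps_to_fls ?P ^ 3 = fls_X ^ (Suc k choose 2)"
    using arg_cong[OF LP, of fps_to_fls]
    by (simp add: fls_times_fps_to_fls fps_to_fls_power)
  \<comment> \<open>Laurent series form a field, so the cleared identity can now be divided by P^3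
    and by the power of q.\<close>
  moreover have "1 / p = inverse x * l" if "l * p = x" "x \<noteq> 0" for l p x :: "'a fls"
    using that by (auto simp: field_simps)
  ultimately have "1 / fps_to_fls ?P ^ 3 = inverse (fls_X ^ (Suc k choose 2)) * fps_to_fls L"
    using fls_X_pow_nonzero by blast
  then have "1 / fps_to_fls ?P ^ 3 = fls_X powi (- int (Suc k choose 2)) * fps_to_fls L"
    unfolding power_int_minus power_int_of_nat .
  then show ?thesis
    unfolding tri using sum by (auto simp: summable_on_def infsumI simp del: fls_X_power_int)
qed

end
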